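(* Let $\{(\mu_j,\zeta_j)\}_{j=1}^n$ be the eigenpairs of $\bar T=\bar R A$, ordered so that $\mu_1\le\mu_2\le\dots\le\mu_n$, with $\{\zeta_j\}$ orthogonal with respect to $(\cdot,\cdot)_{\bar R^{-1}}$. Let $n_c<n$ be an integer with $\dim N\le n_c$. Among all subspaces $V_c\subset V$ with $\dim V_c=n_c$ and $N\subset V_c$, the convergence rate $\|E(V_c)\|_A$ is minimal for the coarse space $$V_c^{\rm opt}=\operatorname{span}\{\zeta_j\}_{j=1}^{n_c}\in\operatorname*{arg\,min}_{\dim V_c=n_c,\ N\subset V_c}K(V_c),$$ and for $V_c=V_c^{\rm opt}$ one has $$\|E\|_A^2=1-\mu_{n_c+1}.$$
   Context: $V$ is a real vector space of finite dimension $n$ with inner product $(\cdot,\cdot)$; its dual is identified with $V$ through this inner product, and $L'$ denotes the adjoint of a linear operator $L$ with respect to $(\cdot,\cdot)$. $A:V\to V$ is a nonzero symmetric positive semidefinite operator, $(u,v)_A=(Au,v)$, $\|v\|_A=(v,v)_A^{1/2}$, and $N=\ker A$. $R:V\to V$ is a linear operator (the smoother) whose symmetrization $\bar R=R+R'-R'AR$ is symmetric positive definite; $(u,v)_{\bar R^{-1}}=(\bar R^{-1}u,v)$ and $\|v\|_{\bar R^{-1}}^2=(v,v)_{\bar R^{-1}}$. For a subspace $V_c\subset V$ (coarse space) with $N\subset V_c$, let $W$ be the orthogonal complement of $N$ with respect to $(\cdot,\cdot)_{\bar R^{-1}}$ and $W_c=V_c\cap W$. Let $\Pi_c:V\to W_c$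 be the projection defined by $(\Pi_cu,v_c)_A=(u,v_c)_A$ for all $u\in V$, $v_c\in W_c$. The error propagation operator of the exact two-level method (exact coarse-grid correction followed by one smoothing step with $R$) is $$E=E(V_c)=(I-RA)(I-\Pi_c),\qquad \|E\|_A=\max_{w\in W\setminus\{0\}}\frac{\|Ew\|_A}{\|w\|_A}.$$ Finally $$K(V_c)=\max_{v\in W\setminus\{0\}}\ \min_{v_c\in W_c}\frac{\|v-v_c\|_{\bar R^{-1}}^2}{\|v\|_A^2}.$$ *)

theory Defs
  imports "HOL-Analysis.Analysis"
begin

definition sym_op :: "('a::euclidean_space \<Rightarrow> 'a) \<Rightarrow> bool" where
  "sym_op L \<longleftrightarrow> linear L \<and> adjoint L = L"

definition spsd_op :: "('a::euclidean_space \<Rightarrow> 'a) \<Rightarrow> bool" where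
  "spsd_op L \<longleftrightarrow> sym_op L \<and> (\<forall>v. 0 \<le> L v \<bullet> v)"

definition spd_op :: "('a::euclidean_space \<Rightarrow> 'a) \<Rightarrow> bool" where
  "spd_op L \<longleftrightarrow> sym_op L \<and> (\<forall>v. v \<noteq> 0 \<longrightarrow> 0 < L v \<bullet> v)"

definition op_inner :: "('a::euclidean_space \<Rightarrow> 'a) \<Rightarrow> 'a \<Rightarrow> 'a \<Rightarrow> real" where
  "op_inner L u v = L u \<bullet> v"

definition op_norm :: "('a::euclidean_space \<Rightarrow> 'a) \<Rightarrow> 'a \<Rightarrow> real" where
  "op_norm L v = sqrt (op_inner L v v)"

definition op_kernel :: "('a::euclidean_space \<Rightarrow> 'a) \<Rightarrow> 'a set" where
  "op_kernel L = {v. L v = 0}"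

definition Rbar :: "('a::euclidean_space \<Rightarrow> 'a) \<Rightarrow> ('a \<Rightarrow> 'a) \<Rightarrow> 'a \<Rightarrow> 'a" where
  "Rbar A R v = R v + adjoint R v - adjoint R (A (R v))"

text \<open>Under the standing assumptions \<^term>\<open>Rbar A R\<close> is positive definite, hence bijective,
  so that \<^term>\<open>inv (Rbar A R)\<close> is a genuine inverse.\<close>

definition W_space :: "('a::euclidean_space \<Rightarrow> 'a) \<Rightarrow> ('a \<Rightarrow> 'a) \<Rightarrow> 'a set" where
  "W_space A R = {w. \<forall>v \<in> op_kernel A. op_inner (inv (Rbar A R)) w v = 0}"

definition W_coarse :: "('a::euclidean_space \<Rightarrow> 'a) \<Rightarrow> ('a \<Rightarrow> 'a) \<Rightarrow> 'a set \<Rightarrow> 'a set" where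
  "W_coarse A R Vc = Vc \<inter> W_space A R"

text \<open>The form given by \<open>A\<close> is an inner product on \<^term>\<open>W_space A R\<close> (which meets the kernel
  of \<open>A\<close> only in \<open>0\<close>), so for a subspace \<open>Vc\<close> the description below determines a unique vector.\<close>

definition coarse_proj ::
  "('a::euclidean_space \<Rightarrow> 'a) \<Rightarrow> ('a \<Rightarrow> 'a) \<Rightarrow> 'a set \<Rightarrow> 'a \<Rightarrow> 'a" where
  "coarse_proj A R Vc u =
     (THE p. p \<in> W_coarse A R Vc \<and>
             (\<forall>vc \<in> W_coarse A R Vc. op_inner A p vc = op_inner A u vc))"

definition two_level_E ::
  "('a::euclidean_space \<Rightarrow> 'a) \<Rightarrow> ('a \<Rightarrow> 'a) \<Rightarrow> 'a set \<Rightarrow> 'a \<Rightarrow> 'a" where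
  "two_level_E A R Vc = (\<lambda>u. u - R (A u)) \<circ> (\<lambda>u. u - coarse_proj A R Vc u)"

text \<open>The maxima and minima below run over infinite sets; \<open>GREATEST\<close> and \<open>LEAST\<close> denote an
  attained maximum and minimum, in contrast to a supremum and infimum.\<close>

definition conv_rate ::
  "('a::euclidean_space \<Rightarrow> 'a) \<Rightarrow> ('a \<Rightarrow> 'a) \<Rightarrow> 'a set \<Rightarrow> real" where
  "conv_rate A R Vc =
     (GREATEST r. \<exists>w \<in> W_space A R - {0}.
        r = op_norm A (two_level_E A R Vc w) / op_norm A w)"

definition K_const ::
  "('a::euclidean_space \<Rightarrow> 'a) \<Rightarrow> ('a \<Rightarrow> 'a) \<Rightarrow> 'a set \<Rightarrow> real" where
  "K_const A R Vc =
     (GREATEST k. \<exists>v \<in> W_space A R - {0}.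
        k = (LEAST m. \<exists>vc \<in> W_coarse A R Vc.
               m = (op_norm (inv (Rbar A R)) (v - vc))\<^sup>2 / (op_norm A v)\<^sup>2))"

definition admissible_coarse :: "('a::euclidean_space \<Rightarrow> 'a) \<Rightarrow> nat \<Rightarrow> 'a set \<Rightarrow> bool" where
  "admissible_coarse A nc Vc \<longleftrightarrow> subspace Vc \<and> dim Vc = nc \<and> op_kernel A \<subseteq> Vc"

end

theory Submission
  imports Defs
begin

text \<open>Put \<open>B = inv (Rbar A R)\<close>. For \<open>w\<close> in \<open>W\<close> let \<open>u\<close> be \<open>w\<close> minus its coarse projection;
  expanding \<open>Rbar A R\<close> gives that the squared \<open>A\<close>-norm of \<open>E w\<close> is \<open>A u \<bullet> u - Rbar A R (A u) \<bullet> A u\<close>.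
  So both the rate and \<open>K\<close> compare two quadratic forms on an orthogonal complement of the coarse
  space, and these forms are diagonal in the basis \<open>\<zeta>\<close>, with successive quotient \<open>\<mu> j\<close>. As in the
  Courant-Fischer principle, a dimension count yields for every coarse space of dimension \<open>nc\<close> an
  orthogonal vector in the span of the first \<open>nc + 1\<close> eigenvectors, hence
  \<open>1 - \<mu> (nc + 1)\<close> as a lower bound of the squared rate and \<open>1 / \<mu> (nc + 1)\<close> as one of \<open>K\<close>. For the span of the
  first \<open>nc\<close> eigenvectors the complement only involves the remaining ones, and both bounds are
  attained.\<close>

section \<open>Linear algebra on subspaces and maxima of scale-invariant functions\<close>

text \<open>Take \<open>L\<close> followed by the orthogonal projection onto \<open>S\<close>.
  Orthogonality of \<open>L x\<close> to \<open>S\<close> thereby becomes \<open>f x = 0\<close> for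
  a linear map into \<open>S\<close>, which dimension counts can handle.\<close>

lemma gram_map_exists:
  fixes L :: "'a::euclidean_space \<Rightarrow> 'a"
  assumes "subspace S" "linear L"
  obtains f where "linear f" "\<And>x. f x \<in> S" "\<And>x s. s \<in> S \<Longrightarrow> f x \<bullet> s = L x \<bullet> s"
proof -
  obtain B where B: "B \<subseteq> S" "pairwise orthogonal B" "\<And>x. x \<in> B \<Longrightarrow> norm x = 1"
      "independent B" "span B = S"
    using orthonormal_basis_subspace[OF assms(1)] by metis
  have fB: "finite B" using B(4) by (rule independent_imp_finite)
  define f where "f x = (\<Sum>b\<in>B. (L x \<bullet> b) *\<^sub>R b)" for x
  have "linear f"
    unfolding f_def
    by (rule linearI)
      (simp_all add: linear_add[OF assms(2)] linear_scale[OF assms(2)] inner_add_left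
        scaleR_add_left sum.distrib scaleR_sum_right)
  moreover have "f x \<in> S" for x
    unfolding f_def using B(1) by (intro subspace_sum[OF assms(1)] subspace_scale[OF assms(1)]) auto
  moreover have "f x \<bullet> s = L x \<bullet> s" if "s \<in> S" for x s
  proof -
    have fb: "f x \<bullet> b = L x \<bullet> b" if b: "b \<in> B" for b
    proof -
      have "(\<Sum>c\<in>B. (L x \<bullet> c) * (c \<bullet> b)) = (\<Sum>c\<in>B. if c = b then L x \<bullet> b else 0)"
        using B(2,3) b by (intro sum.cong)
          (auto simp: pairwise_def orthogonal_def norm_eq_1)
      then show ?thesis using b fB by (simp add: f_def inner_sum_left)
    qed
    have "subspace {s. f x \<bullet> s = L x \<bullet> s}"
      by (auto simp: subspace_def inner_add_right)
    then have "span B \<subseteq> {s. f x \<bullet> s = L x \<bullet> s}"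
      using fb by (intro span_minimal) auto
    then show ?thesis using that B(5) by auto
  qed
  ultimately show ?thesis using that by blast
qed

text \<open>An injective \<open>f\<close> would preserve the dimension of \<open>T\<close>, which
  does not fit into \<open>S\<close>. The test vectors of both lower bounds arise in this
  way.\<close>

lemma linear_kernel_vector:
  fixes f :: "'a::euclidean_space \<Rightarrow> 'a"
  assumes "linear f" "subspace T" "f ` T \<subseteq> S" "dim S < dim T"
  obtains u where "u \<in> T" "u \<noteq> 0" "f u = 0"
proof -
  have "\<not> inj_on f T"
  proof
    assume "inj_on f T"
    then have "dim (f ` T) = dim T"
      using assms(1,2) by (intro dim_image_eq) (auto simp: span_eq_iff[THEN iffD2])
    then show False using dim_subset[OF assms(3)] assms(4) by simp
  qed
  then show ?thesis
    using that linear_inj_on_iff_eq_0[OF assms(1,2)] by blast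
qed

text \<open>Positivity makes the Gram map \<open>f\<close> injective on \<open>S\<close>, hence a
  bijection of \<open>S\<close> by dimension; \<open>P\<close> is \<open>f\<close> followed by the
  inverse of that bijection. It serves twice: for \<open>A\<close>, giving the coarse projection,
  and for \<open>inv (Rbar A R)\<close>, giving the minimiser inside \<open>K_const\<close>.\<close>

lemma form_projection_exists:
  fixes L :: "'a::euclidean_space \<Rightarrow> 'a"
  assumes S: "subspace S" and L: "linear L"
    and pos: "\<And>s. s \<in> S \<Longrightarrow> s \<noteq> 0 \<Longrightarrow> 0 < L s \<bullet> s"
  obtains P where "linear P" "\<And>u. P u \<in> S" "\<And>u s. s \<in> S \<Longrightarrow> L (P u) \<bullet> s = L u \<bullet> s"
    "\<And>u p. p \<in> S \<Longrightarrow> (\<And>s. s \<in> S \<Longrightarrow> L p \<bullet> s = L u \<bullet> s) \<Longrightarrow> p = P u"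
proof -
  obtain f where f: "linear f" "\<And>x. f x \<in> S" "\<And>x s. s \<in> S \<Longrightarrow> f x \<bullet> s = L x \<bullet> s"
    using gram_map_exists[OF S L] by blast
  have inj: "inj_on f S"
    unfolding linear_inj_on_iff_eq_0[OF f(1) S]
    using f(3) pos by (metis inner_zero_left less_irrefl)
  then have "dim (f ` S) = dim S"
    using f(1) S by (intro dim_image_eq) (auto simp: span_eq_iff[THEN iffD2])
  then have im: "f ` S = S"
    using subspace_dim_equal[of "f ` S" S] linear_subspace_image[OF f(1) S] S f(2) by auto
  obtain g where g: "range g \<subseteq> S" "linear g" "\<forall>v\<in>S. g (f v) = v"
    using linear_exists_left_inverse_on[OF f(1) S inj] by blast
  \<comment> \<open>\<open>g\<close> is only known to be a left inverse on \<open>S\<close>; as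
    \<open>f\<close> maps \<open>S\<close> onto \<open>S\<close>, it is a right inverse there
    too.\<close>
  have fg: "f (g (f u)) = f u" for u
    using im f(2)[of u] g(3) by (metis imageE)
  have "linear (g \<circ> f)" using linear_compose[OF f(1) g(2)] .
  moreover have "(g \<circ> f) u \<in> S" for u using g(1) by auto
  moreover have "L ((g \<circ> f) u) \<bullet> s = L u \<bullet> s" if "s \<in> S" for u s
    using f(3)[OF that] fg[of u] by (metis comp_apply)
  moreover have "p = (g \<circ> f) u" if p: "p \<in> S" "\<And>s. s \<in> S \<Longrightarrow> L p \<bullet> s = L u \<bullet> s" for u p
  proof -
    have "(f p - f u) \<bullet> s = 0" if "s \<in> S" for s
      using f(3)[OF that] p(2)[OF that] by (simp add: inner_diff_left)
    moreover have "f p - f u \<in> S" using f(2) S by (simp add: subspace_diff)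
    ultimately have "f p = f u" by (metis inner_eq_zero_iff eq_iff_diff_eq_0)
    then show ?thesis using g(3) p(1) by (metis comp_apply)
  qed
  ultimately show ?thesis by (rule that)
qed

text \<open>Scale invariance reduces the search to the unit sphere of \<open>S\<close>, which is
  compact in finite dimension. Continuity at 0 is not to be expected of a quotient of forms.\<close>

lemma homogeneous_attains_max:
  fixes F :: "'a::euclidean_space \<Rightarrow> real"
  assumes S: "subspace S" and ne: "x0 \<in> S" "x0 \<noteq> 0"
    and cont: "continuous_on (S - {0}) F"
    and hom: "\<And>c x. c > 0 \<Longrightarrow> F (c *\<^sub>R x) = F x"
  obtains w where "w \<in> S - {0}" "\<And>x. x \<in> S - {0} \<Longrightarrow> F x \<le> F w"
proof -
  let ?K = "S \<inter> sphere 0 1"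
  have nrm: "(1 / norm x) *\<^sub>R x \<in> ?K" if "x \<in> S - {0}" for x
    using that S by (auto simp: subspace_scale)
  have "compact ?K" using closed_subspace[OF S] by (simp add: closed_Int_compact)
  moreover have "?K \<noteq> {}" using nrm ne by blast
  moreover have "continuous_on ?K F" using cont by (rule continuous_on_subset) auto
  ultimately obtain w where w: "w \<in> ?K" "\<And>x. x \<in> ?K \<Longrightarrow> F x \<le> F w"
    using continuous_attains_sup[of ?K F] by blast
  show ?thesis
  proof
    show "w \<in> S - {0}" using w(1) by auto
    show "F x \<le> F w" if "x \<in> S - {0}" for x
      using w(2)[OF nrm[OF that]] hom[of "1 / norm x" x] that by auto
  qed
qed

section \<open>The operators \<open>A\<close>, \<open>Rbar A R\<close> and its inverse, and the
  space \<open>W\<close>\<close>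

locale two_level =
  fixes A R :: "'a::euclidean_space \<Rightarrow> 'a"
  assumes A: "spsd_op A" and R: "linear R" and Rbar: "spd_op (Rbar A R)"
begin

abbreviation "B \<equiv> inv (Rbar A R)"
abbreviation "W \<equiv> W_space A R"
abbreviation "N \<equiv> op_kernel A"

lemma linear_A: "linear A" and A_sym: "A u \<bullet> v = A v \<bullet> u" and A_nonneg: "0 \<le> A v \<bullet> v"
proof -
  show l: "linear A" and "0 \<le> A v \<bullet> v" using A by (auto simp: spsd_op_def sym_op_def)
  show "A u \<bullet> v = A v \<bullet> u"
    using adjoint_works[OF l, of u v] A by (simp add: spsd_op_def sym_op_def inner_commute)
qed

lemma linear_Rbar: "linear (Rbar A R)" and Rbar_sym: "Rbar A R u \<bullet> v = Rbar A R v \<bullet> u"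
  and Rbar_pos: "v \<noteq> 0 \<Longrightarrow> 0 < Rbar A R v \<bullet> v"
proof -
  show l: "linear (Rbar A R)" and "v \<noteq> 0 \<Longrightarrow> 0 < Rbar A R v \<bullet> v"
    using Rbar by (auto simp: spd_op_def sym_op_def)
  show "Rbar A R u \<bullet> v = Rbar A R v \<bullet> u"
    using adjoint_works[OF l, of u v] Rbar by (simp add: spd_op_def sym_op_def inner_commute)
qed

lemma bij_Rbar: "bij (Rbar A R)"
proof -
  have "inj (Rbar A R)"
    unfolding linear_injective_0[OF linear_Rbar]
    using Rbar_pos by (metis inner_zero_left less_irrefl)
  then show ?thesis
    using linear_injective_imp_surjective[OF linear_Rbar] by (simp add: bij_def)
qed

lemma Rbar_B [simp]: "Rbar A R (B v) = v" and B_Rbar [simp]: "B (Rbar A R v) = v"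
  using bij_Rbar by (simp_all add: bij_def surj_f_inv_f)

lemma linear_B: "linear B"
proof (rule linearI)
  show "B (u + v) = B u + B v" for u v
    by (metis B_Rbar Rbar_B linear_add[OF linear_Rbar])
  show "B (c *\<^sub>R u) = c *\<^sub>R B u" for c u
    by (metis B_Rbar Rbar_B linear_scale[OF linear_Rbar])
qed

lemma B_sym: "B u \<bullet> v = B v \<bullet> u"
  by (metis Rbar_B Rbar_sym inner_commute)

lemma B_pos: assumes "v \<noteq> 0" shows "0 < B v \<bullet> v"
proof -
  have "B v \<noteq> 0" using assms by (metis Rbar_B linear_0[OF linear_Rbar])
  from Rbar_pos[OF this] show ?thesis by (simp add: inner_commute)
qed

lemma A_add_square:
  assumes "A u \<bullet> v = 0" shows "A (u + v) \<bullet> (u + v) = A u \<bullet> u + A v \<bullet> v"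
  using assms A_sym[of u v] by (simp add: linear_add[OF linear_A] inner_add_left inner_add_right)

text \<open>Along \<open>v\<close> plus \<open>t\<close> times \<open>A v\<close> the energy is a
  quadratic polynomial in \<open>t\<close> without constant term. It stays nonnegative only if its
  linear coefficient, twice the squared length of \<open>A v\<close>, is zero.\<close>

lemma A_square_zero: assumes "A v \<bullet> v = 0" shows "A v = 0"
proof -
  let ?q = "A (A v) \<bullet> A v" let ?p = "A v \<bullet> A v"
  have "0 \<le> 2 * t * ?p + t\<^sup>2 * ?q" for t
    using A_nonneg[of "v + t *\<^sub>R A v"] assms A_sym[of "A v" v]
    by (simp add: linear_add[OF linear_A] linear_scale[OF linear_A] inner_add_left inner_add_right
        power2_eq_square algebra_simps)
  \<comment> \<open>The minimiser would be \<open>- ?p / ?q\<close>; the shift covers \<open>?q = 0\<close>.\<close>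
  from this[of "- (?p / (?q + 1))"] have "0 \<le> - 2 * (?p / (?q + 1)) * ?p + (?p / (?q + 1))\<^sup>2 * ?q"
    by simp
  moreover have q: "0 \<le> ?q" by (rule A_nonneg)
  then have "(?p / (?q + 1))\<^sup>2 * ?q \<le> (?p / (?q + 1))\<^sup>2 * (?q + 1)"
    by (intro mult_left_mono) auto
  moreover have "(?p / (?q + 1))\<^sup>2 * (?q + 1) = (?p / (?q + 1)) * ?p"
    using q by (simp add: power2_eq_square)
  ultimately have "(?p / (?q + 1)) * ?p \<le> 0" by linarith
  then have "?p * ?p \<le> 0" using q by (simp add: divide_le_0_iff)
  then have "?p = 0" by (meson mult_eq_0_iff not_square_less_zero order_le_less)
  then show ?thesis by simp
qed

text \<open>The terms linear and quadratic in \<open>R\<close> collect to \<open>Rbar A R\<close>,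
  which thus measures the energy removed by one smoothing step.\<close>

lemma smoothing_energy:
  "A (u - R (A u)) \<bullet> (u - R (A u)) = A u \<bullet> u - Rbar A R (A u) \<bullet> A u"
proof -
  have adj: "adjoint R x \<bullet> y = x \<bullet> R y" for x y
    using adjoint_works[OF R, of y x] by (simp add: inner_commute)
  show ?thesis
    using A_sym[of "R (A u)" u] adj
    by (simp add: Rbar_def linear_diff[OF linear_A] inner_diff_left inner_diff_right
        inner_add_left inner_add_right inner_commute)
qed

lemma subspace_N: "subspace N"
  unfolding op_kernel_def by (rule linear_subspace_kernel[OF linear_A])

lemma W_iff: "w \<in> W \<longleftrightarrow> (\<forall>v\<in>N. B w \<bullet> v = 0)"
  by (simp add: W_space_def op_inner_def)

lemma subspace_W: "subspace W"
  by (auto simp: subspace_def W_iff linear_0[OF linear_B] linear_add[OF linear_B]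
      linear_scale[OF linear_B] inner_add_left)

lemma W_inter_N: assumes "w \<in> W" "w \<in> N" shows "w = 0"
  using assms B_pos W_iff by (metis less_irrefl)

text \<open>\<open>W\<close> meets the kernel only in 0. This keeps the denominators of both
  quotients positive and makes the coarse projection unique.\<close>

lemma A_pos: assumes "w \<in> W" "w \<noteq> 0" shows "0 < A w \<bullet> w"
proof -
  have "A w \<noteq> 0" using assms W_inter_N by (auto simp: op_kernel_def)
  then show ?thesis using A_nonneg[of w] A_square_zero[of w] by linarith
qed

section \<open>Coarse projection and attainment of the extremal values\<close>

lemma subspace_W_coarse: "subspace Vc \<Longrightarrow> subspace (W_coarse A R Vc)"
  unfolding W_coarse_def by (simp add: subspace_inter subspace_W)

text \<open>Since \<open>A\<close> is definite on \<open>W\<close>,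
  \<open>form_projection_exists\<close> applies on the coarse part of \<open>W\<close>, and the
  definite description denotes its \<open>P\<close>.\<close>

lemma coarse_proj_props:
  assumes "subspace Vc"
  shows linear_coarse_proj: "linear (coarse_proj A R Vc)"
    and coarse_proj_in: "coarse_proj A R Vc u \<in> W_coarse A R Vc"
    and coarse_proj_eq: "s \<in> W_coarse A R Vc \<Longrightarrow> A (coarse_proj A R Vc u) \<bullet> s = A u \<bullet> s"
    and coarse_proj_unique: "p \<in> W_coarse A R Vc \<Longrightarrow>
      (\<And>s. s \<in> W_coarse A R Vc \<Longrightarrow> A p \<bullet> s = A u \<bullet> s) \<Longrightarrow> coarse_proj A R Vc u = p"
proof -
  obtain P where P: "linear P" "\<And>u. P u \<in> W_coarse A R Vc"
    "\<And>u s. s \<in> W_coarse A R Vc \<Longrightarrow> A (P u) \<bullet> s = A u \<bullet> s"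
    "\<And>u p. p \<in> W_coarse A R Vc \<Longrightarrow>
      (\<And>s. s \<in> W_coarse A R Vc \<Longrightarrow> A p \<bullet> s = A u \<bullet> s) \<Longrightarrow> p = P u"
    using form_projection_exists[OF subspace_W_coarse[OF assms] linear_A] A_pos
    unfolding W_coarse_def by blast
  have "coarse_proj A R Vc = P"
    unfolding coarse_proj_def op_inner_def using P by (intro ext the_equality) auto
  then show "linear (coarse_proj A R Vc)" "coarse_proj A R Vc u \<in> W_coarse A R Vc"
    "s \<in> W_coarse A R Vc \<Longrightarrow> A (coarse_proj A R Vc u) \<bullet> s = A u \<bullet> s"
    "p \<in> W_coarse A R Vc \<Longrightarrow>
      (\<And>s. s \<in> W_coarse A R Vc \<Longrightarrow> A p \<bullet> s = A u \<bullet> s) \<Longrightarrow> coarse_proj A R Vc u = p"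
    using P by auto
qed

lemma two_level_energy:
  defines "e Vc w \<equiv> w - coarse_proj A R Vc w"
  shows "(op_norm A (two_level_E A R Vc w))\<^sup>2 = A (e Vc w) \<bullet> e Vc w - Rbar A R (A (e Vc w)) \<bullet> A (e Vc w)"
  using A_nonneg unfolding op_norm_def op_inner_def two_level_E_def comp_def e_def
  by (simp add: smoothing_energy[symmetric])

text \<open>The quotient is scale invariant and continuous off 0, so \<open>GREATEST\<close> denotes
  a true maximum; \<open>x0\<close> guarantees that it ranges over a nonempty set.\<close>

lemma conv_rate_attained:
  assumes Vc: "subspace Vc" and ne: "x0 \<in> W" "x0 \<noteq> 0"
  defines "F w \<equiv> op_norm A (two_level_E A R Vc w) / op_norm A w"
  shows conv_rate_witness: "\<exists>w\<in>W - {0}. conv_rate A R Vc = F w"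
    and conv_rate_upper: "\<And>w. w \<in> W - {0} \<Longrightarrow> F w \<le> conv_rate A R Vc"
proof -
  let ?E = "two_level_E A R Vc"
  have id_minus: "linear (\<lambda>u. u - L u)" if "linear L" for L :: "'a \<Rightarrow> 'a"
    using linear_compose_sub[OF linear_id that] by (simp add: id_def)
  have linE: "linear ?E"
    unfolding two_level_E_def
    using linear_compose[OF linear_A R]
    by (intro linear_compose id_minus linear_coarse_proj[OF Vc]) (simp add: comp_def)
  have cont: "continuous_on (W - {0}) F"
    unfolding F_def op_norm_def op_inner_def
    using A_pos linear_continuous_on_compose[OF continuous_on_id linear_A]
      linear_continuous_on_compose[OF continuous_on_id linE]
      linear_continuous_on_compose[OF continuous_on_id linear_compose[OF linE linear_A]]
    by (intro continuous_intros) (auto simp: id_def comp_def, fastforce)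
  have nrm: "op_norm A (c *\<^sub>R x) = c * op_norm A x" if "c > 0" for c x
    using that by (simp add: op_norm_def op_inner_def linear_scale[OF linear_A] real_sqrt_mult)
  have hom: "F (c *\<^sub>R x) = F x" if "c > 0" for c x
    using that by (simp add: F_def nrm linear_scale[OF linE])
  obtain w where w: "w \<in> W - {0}" "\<And>x. x \<in> W - {0} \<Longrightarrow> F x \<le> F w"
    using homogeneous_attains_max[OF subspace_W ne cont hom] by blast
  have "conv_rate A R Vc = F w"
    unfolding conv_rate_def using w by (intro Greatest_equality) (auto simp: F_def)
  then show "\<exists>w\<in>W - {0}. conv_rate A R Vc = F w" "\<And>w. w \<in> W - {0} \<Longrightarrow> F w \<le> conv_rate A R Vc"
    using w by auto
qed

text \<open>The inner minimum is reached at the projection \<open>Q u\<close> orthogonal for the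
  form of \<open>B\<close>. What remains is to maximise a quotient of two quadratic forms, as for
  the rate.\<close>

lemma K_const_attained:
  assumes Vc: "subspace Vc" and ne: "x0 \<in> W" "x0 \<noteq> 0"
  obtains Q v where "\<And>u. Q u \<in> W_coarse A R Vc"
    "\<And>u s. s \<in> W_coarse A R Vc \<Longrightarrow> B (Q u) \<bullet> s = B u \<bullet> s"
    "v \<in> W - {0}" "K_const A R Vc = B (v - Q v) \<bullet> (v - Q v) / (A v \<bullet> v)"
    "\<And>u. u \<in> W - {0} \<Longrightarrow> B (u - Q u) \<bullet> (u - Q u) / (A u \<bullet> u) \<le> K_const A R Vc"
proof -
  let ?S = "W_coarse A R Vc"
  have S: "subspace ?S" by (rule subspace_W_coarse[OF Vc])
  obtain Q where Q: "linear Q" "\<And>u. Q u \<in> ?S" "\<And>u s. s \<in> ?S \<Longrightarrow> B (Q u) \<bullet> s = B u \<bullet> s"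
    using form_projection_exists[OF S linear_B] B_pos by metis
  define G where "G u = B (u - Q u) \<bullet> (u - Q u) / (A u \<bullet> u)" for u
  have B_nonneg: "0 \<le> B x \<bullet> x" for x
    using B_pos[of x] linear_0[OF linear_B] by (cases "x = 0") auto
  \<comment> \<open>Pythagoras for \<open>B\<close>: split \<open>u - s\<close> into
    \<open>u - Q u\<close> and \<open>Q u - s\<close>.\<close>
  have best: "B (u - Q u) \<bullet> (u - Q u) \<le> B (u - s) \<bullet> (u - s)" if "s \<in> ?S" for u s
  proof -
    have d: "Q u - s \<in> ?S" using Q(2) that S by (simp add: subspace_diff)
    have "B (u - Q u) \<bullet> (Q u - s) = 0"
      using Q(3)[OF d, of u] by (simp add: linear_diff[OF linear_B] inner_diff_left)
    then have "B (u - Q u + (Q u - s)) \<bullet> (u - Q u + (Q u - s)) =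
        B (u - Q u) \<bullet> (u - Q u) + B (Q u - s) \<bullet> (Q u - s)"
      using B_sym[of "Q u - s" "u - Q u"]
      by (simp only: linear_add[OF linear_B] inner_add_left inner_add_right)
    then show ?thesis using B_nonneg[of "Q u - s"] by simp
  qed
  have least: "(LEAST m. \<exists>vc\<in>?S. m = (op_norm B (u - vc))\<^sup>2 / (op_norm A u)\<^sup>2) = G u" for u
    unfolding op_norm_def op_inner_def G_def
    using Q(2) best B_nonneg A_nonneg
    by (intro Least_equality) (auto simp: divide_right_mono)
  have cont: "continuous_on (W - {0}) G"
    unfolding G_def linear_diff[OF linear_B]
    using A_pos linear_continuous_on_compose[OF continuous_on_id linear_A]
      linear_continuous_on_compose[OF continuous_on_id linear_B]
      linear_continuous_on_compose[OF continuous_on_id Q(1)]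
      linear_continuous_on_compose[OF continuous_on_id linear_compose[OF Q(1) linear_B]]
    by (intro continuous_intros) (auto simp: id_def comp_def, fastforce)
  have hom: "G (c *\<^sub>R x) = G x" if "c > 0" for c x
    using that by (simp add: G_def linear_scale[OF linear_A] linear_scale[OF linear_B]
        linear_scale[OF Q(1)] flip: scaleR_diff_right)
  obtain v where v: "v \<in> W - {0}" "\<And>x. x \<in> W - {0} \<Longrightarrow> G x \<le> G v"
    using homogeneous_attains_max[OF subspace_W ne cont hom] by blast
  have "K_const A R Vc = G v"
    unfolding K_const_def least using v by (intro Greatest_equality) auto
  then show ?thesis using that[of Q v] Q v unfolding G_def by metis
qed

end

section \<open>Coordinates in the eigenbasis\<close>

locale two_level_eig = two_level A R
  for A R :: "'a::euclidean_space \<Rightarrow> 'a" +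
  fixes \<mu> :: "nat \<Rightarrow> real" and \<zeta> :: "nat \<Rightarrow> 'a"
  assumes zeta_nz: "j \<in> {1..DIM('a)} \<Longrightarrow> \<zeta> j \<noteq> 0"
    and zeta_eig: "j \<in> {1..DIM('a)} \<Longrightarrow> Rbar A R (A (\<zeta> j)) = \<mu> j *\<^sub>R \<zeta> j"
    and mu_mono: "i \<in> {1..DIM('a)} \<Longrightarrow> j \<in> {1..DIM('a)} \<Longrightarrow> i \<le> j \<Longrightarrow> \<mu> i \<le> \<mu> j"
    and zeta_orth: "i \<in> {1..DIM('a)} \<Longrightarrow> j \<in> {1..DIM('a)} \<Longrightarrow> i \<noteq> j \<Longrightarrow> B (\<zeta> i) \<bullet> \<zeta> j = 0"
begin

text \<open>The eigenvectors are orthogonal for \<open>B\<close> but not normalised, so coordinates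
  are divided by the squared length \<open>b j\<close>.\<close>

definition "b j = B (\<zeta> j) \<bullet> \<zeta> j"
definition "coef v j = B v \<bullet> \<zeta> j / b j"

lemma b_pos: "j \<in> {1..DIM('a)} \<Longrightarrow> 0 < b j"
  unfolding b_def using B_pos zeta_nz by blast

text \<open>The eigenproblem in generalised symmetric form: the basis is orthogonal for
  \<open>A\<close> as well as for \<open>B\<close>.\<close>

lemma A_zeta: "j \<in> {1..DIM('a)} \<Longrightarrow> A (\<zeta> j) = \<mu> j *\<^sub>R B (\<zeta> j)"
  by (metis B_Rbar zeta_eig linear_scale[OF linear_B])

lemma B_zeta: "j \<in> {1..DIM('a)} \<Longrightarrow> B v \<bullet> \<zeta> j = coef v j * b j"
  using b_pos[of j] by (simp add: coef_def)

lemma A_zeta_coef: "j \<in> {1..DIM('a)} \<Longrightarrow> A v \<bullet> \<zeta> j = \<mu> j * coef v j * b j"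
  using A_sym[of v "\<zeta> j"] B_sym[of v "\<zeta> j"] B_zeta[of j v] by (simp add: A_zeta)

text \<open>A repeated vector would be orthogonal to itself. Dimensions of spans of images are
  counted by index through this.\<close>

lemma inj_zeta: "inj_on \<zeta> {1..DIM('a)}"
proof (rule inj_onI, rule ccontr)
  fix i j assume "i \<in> {1..DIM('a)}" "j \<in> {1..DIM('a)}" "\<zeta> i = \<zeta> j" "i \<noteq> j"
  then show False using zeta_orth[of i j] B_pos[OF zeta_nz[of j]] by simp
qed

lemma B_sum_zeta:
  assumes "i \<in> {1..DIM('a)}"
  shows "B (\<Sum>j\<in>{1..DIM('a)}. c j *\<^sub>R \<zeta> j) \<bullet> \<zeta> i = c i * b i"
proof -
  have "B (\<Sum>j\<in>{1..DIM('a)}. c j *\<^sub>R \<zeta> j) \<bullet> \<zeta> i = (\<Sum>j\<in>{1..DIM('a)}. c j * (B (\<zeta> j) \<bullet> \<zeta> i))"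
    by (simp add: linear_sum[OF linear_B] linear_scale[OF linear_B] inner_sum_left)
  also have "\<dots> = (\<Sum>j\<in>{1..DIM('a)}. if j = i then c i * b i else 0)"
    using assms by (intro sum.cong) (auto simp: zeta_orth b_def)
  finally show ?thesis using assms by simp
qed

lemma independent_zeta: "independent (\<zeta> ` {1..DIM('a)})"
proof (rule independent_if_scalars_zero)
  fix f x assume 0: "(\<Sum>x\<in>\<zeta> ` {1..DIM('a)}. f x *\<^sub>R x) = 0" and "x \<in> \<zeta> ` {1..DIM('a)}"
  then obtain i where i: "i \<in> {1..DIM('a)}" "x = \<zeta> i" by blast
  have "(\<Sum>j\<in>{1..DIM('a)}. f (\<zeta> j) *\<^sub>R \<zeta> j) = 0"
    using 0 sum.reindex[OF inj_zeta, of "\<lambda>x. f x *\<^sub>R x"] by (simp add: comp_def)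
  then show "f x = 0"
    using B_sum_zeta[OF i(1), of "\<lambda>j. f (\<zeta> j)"] b_pos[OF i(1)] i(2)
    by (simp add: linear_0[OF linear_B])
qed simp

lemma dim_span_zeta: "q \<le> DIM('a) \<Longrightarrow> dim (span (\<zeta> ` {1..q})) = q"
  using independent_mono[OF independent_zeta, of "\<zeta> ` {1..q}"] inj_on_subset[OF inj_zeta, of "{1..q}"]
  by (simp add: dim_eq_card_independent card_image image_mono)

lemma span_zeta: "span (\<zeta> ` {1..DIM('a)}) = UNIV"
  using dim_span_zeta[of "DIM('a)"] by (simp add: dim_eq_full)

text \<open>The remainder is orthogonal for \<open>B\<close> to every basis vector, hence to
  itself.\<close>

lemma zeta_expansion: "v = (\<Sum>j\<in>{1..DIM('a)}. coef v j *\<^sub>R \<zeta> j)"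
proof -
  define x where "x = v - (\<Sum>j\<in>{1..DIM('a)}. coef v j *\<^sub>R \<zeta> j)"
  have "B x \<bullet> \<zeta> i = 0" if "i \<in> {1..DIM('a)}" for i
    using B_zeta[OF that, of v] B_sum_zeta[OF that, of "coef v"]
    by (simp add: x_def linear_diff[OF linear_B] inner_diff_left)
  moreover have "subspace {y. B x \<bullet> y = 0}" by (auto simp: subspace_def inner_add_right)
  ultimately have "span (\<zeta> ` {1..DIM('a)}) \<subseteq> {y. B x \<bullet> y = 0}" by (intro span_minimal) auto
  then have "B x \<bullet> x = 0" using span_zeta by blast
  then have "x = 0" using B_pos[of x] by fastforce
  then show ?thesis by (simp add: x_def)
qed

lemma inner_expansion: "x \<bullet> v = (\<Sum>j\<in>{1..DIM('a)}. coef v j * (x \<bullet> \<zeta> j))"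
  by (subst zeta_expansion[of v]) (simp add: inner_sum_right)

lemma B_square: "B v \<bullet> v = (\<Sum>j\<in>{1..DIM('a)}. (coef v j)\<^sup>2 * b j)"
  unfolding inner_expansion[of "B v" v] by (intro sum.cong) (simp_all add: B_zeta power2_eq_square)

lemma A_square: "A v \<bullet> v = (\<Sum>j\<in>{1..DIM('a)}. \<mu> j * (coef v j)\<^sup>2 * b j)"
  unfolding inner_expansion[of "A v" v]
  by (intro sum.cong) (simp_all add: A_zeta_coef power2_eq_square)

text \<open>One factor \<open>\<mu> j\<close> comes from \<open>Rbar A R\<close> after
  \<open>A\<close> acting on coordinates, the other from \<open>A_zeta_coef\<close>.\<close>

lemma RbarA_square: "Rbar A R (A v) \<bullet> A v = (\<Sum>j\<in>{1..DIM('a)}. (\<mu> j)\<^sup>2 * (coef v j)\<^sup>2 * b j)"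
proof -
  have "coef (Rbar A R (A v)) j = \<mu> j * coef v j" if "j \<in> {1..DIM('a)}" for j
    using A_zeta_coef[OF that, of v] b_pos[OF that] by (simp add: coef_def[of "Rbar A R (A v)"])
  then show ?thesis
    using inner_expansion[of "A v" "Rbar A R (A v)"]
    by (subst inner_commute) (simp add: A_zeta_coef power2_eq_square algebra_simps)
qed

lemma mu_nonneg: assumes "j \<in> {1..DIM('a)}" shows "0 \<le> \<mu> j"
  using A_nonneg[of "\<zeta> j"] b_pos[OF assms] by (simp add: A_zeta[OF assms] b_def zero_le_mult_iff)

text \<open>For nonzero \<open>\<mu> j\<close> the vector \<open>B (\<zeta> j)\<close> is a multiple
  of \<open>A (\<zeta> j)\<close>, which is orthogonal to the kernel of the symmetric
  \<open>A\<close>.\<close>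

lemma zeta_N_or_W: assumes "j \<in> {1..DIM('a)}" shows "\<zeta> j \<in> N \<or> (0 < \<mu> j \<and> \<zeta> j \<in> W)"
proof (cases "\<mu> j = 0")
  case True
  then show ?thesis using A_zeta[OF assms] by (simp add: op_kernel_def)
next
  case False
  have "B (\<zeta> j) \<bullet> z = 0" if "z \<in> N" for z
    using A_sym[of "\<zeta> j" z] A_zeta[OF assms] that False by (simp add: op_kernel_def)
  then show ?thesis using False mu_nonneg[OF assms] by (simp add: W_iff)
qed

lemma coef_span:
  assumes "v \<in> span (\<zeta> ` {1..q})" "q \<le> DIM('a)" "j \<in> {1..DIM('a)}" "q < j"
  shows "coef v j = 0"
proof -
  have "subspace {y. B y \<bullet> \<zeta> j = 0}"
    by (auto simp: subspace_def linear_0[OF linear_B] linear_add[OF linear_B]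
      linear_scale[OF linear_B] inner_add_left)
  then have "span (\<zeta> ` {1..q}) \<subseteq> {y. B y \<bullet> \<zeta> j = 0}"
    using assms(2-4) by (intro span_minimal) (auto intro!: zeta_orth)
  then show ?thesis using assms(1) by (auto simp: coef_def)
qed

lemma span_if_coef:
  assumes "\<And>j. j \<in> {1..DIM('a)} \<Longrightarrow> q < j \<Longrightarrow> coef v j = 0"
  shows "v \<in> span (\<zeta> ` {1..q})"
proof -
  have "coef v j *\<^sub>R \<zeta> j \<in> span (\<zeta> ` {1..q})" if "j \<in> {1..DIM('a)}" for j
    using assms[OF that] that by (cases "j \<le> q") (auto intro!: span_scale[OF span_base] span_zero)
  then show ?thesis by (subst zeta_expansion) (blast intro: span_sum)
qed

section \<open>Comparison of the quadratic forms at the two ends of the spectrum\<close>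

lemma low_energy:
  assumes k: "k \<in> {1..DIM('a)}" and u: "u \<in> span (\<zeta> ` {1..k})"
  shows "Rbar A R (A u) \<bullet> A u \<le> \<mu> k * (A u \<bullet> u)" "A u \<bullet> u \<le> \<mu> k * (B u \<bullet> u)"
proof -
  \<comment> \<open>Termwise comparison in one statement: beyond \<open>k\<close> the coordinate
    vanishes, up to \<open>k\<close> the eigenvalues are ordered.\<close>
  have *: "\<mu> j * t \<le> \<mu> k * t" if "j \<in> {1..DIM('a)}" "t = 0 \<or> j \<le> k \<and> 0 \<le> t" for j t
    using that mu_mono[OF _ k] by (auto intro: mult_right_mono)
  have c: "coef u j = 0 \<or> j \<le> k" if "j \<in> {1..DIM('a)}" for j
    using coef_span[OF u _ that] k by force
  have n: "0 \<le> b j" "0 \<le> \<mu> j" if "j \<in> {1..DIM('a)}" for j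
    using b_pos[OF that] mu_nonneg[OF that] by auto
  show "Rbar A R (A u) \<bullet> A u \<le> \<mu> k * (A u \<bullet> u)"
    unfolding RbarA_square A_square sum_distrib_left
  proof (rule sum_mono)
    fix j assume j: "j \<in> {1..DIM('a)}"
    show "(\<mu> j)\<^sup>2 * (coef u j)\<^sup>2 * b j \<le> \<mu> k * (\<mu> j * (coef u j)\<^sup>2 * b j)"
      using *[OF j, of "\<mu> j * (coef u j)\<^sup>2 * b j"] c[OF j]
        mult_nonneg_nonneg[OF mult_nonneg_nonneg[OF n(2)[OF j] zero_le_power2[of "coef u j"]] n(1)[OF j]]
      by (auto simp: power2_eq_square mult.assoc)
  qed
  show "A u \<bullet> u \<le> \<mu> k * (B u \<bullet> u)"
    unfolding A_square B_square sum_distrib_left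
  proof (rule sum_mono)
    fix j assume j: "j \<in> {1..DIM('a)}"
    show "\<mu> j * (coef u j)\<^sup>2 * b j \<le> \<mu> k * ((coef u j)\<^sup>2 * b j)"
      using *[OF j, of "(coef u j)\<^sup>2 * b j"] c[OF j] n[OF j] by (auto simp: mult.assoc)
  qed
qed

text \<open>Orthogonality for \<open>A\<close> kills only the product of \<open>\<mu> j\<close> and
  the coordinate, so kernel components may survive. This is enough, since all terms of both sums
  carry a factor \<open>\<mu> j\<close>.\<close>

lemma high_energy_A:
  assumes k: "k \<in> {1..DIM('a)}" and u: "\<And>j. j \<in> {1..DIM('a)} \<Longrightarrow> j < k \<Longrightarrow> A u \<bullet> \<zeta> j = 0"
  shows "\<mu> k * (A u \<bullet> u) \<le> Rbar A R (A u) \<bullet> A u"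
  unfolding RbarA_square A_square sum_distrib_left
proof (rule sum_mono)
  fix j assume j: "j \<in> {1..DIM('a)}"
  show "\<mu> k * (\<mu> j * (coef u j)\<^sup>2 * b j) \<le> (\<mu> j)\<^sup>2 * (coef u j)\<^sup>2 * b j"
  proof (cases "j < k")
    case True
    then show ?thesis using u[OF j] A_zeta_coef[OF j, of u] b_pos[OF j] by auto
  next
    case False
    then have "\<mu> k * (\<mu> j * (coef u j)\<^sup>2 * b j) \<le> \<mu> j * (\<mu> j * (coef u j)\<^sup>2 * b j)"
      using mu_mono[OF k j] b_pos[OF j] mu_nonneg[OF j] by (intro mult_right_mono) auto
    then show ?thesis by (simp add: power2_eq_square mult.assoc)
  qed
qed

text \<open>Orthogonality for \<open>B\<close> kills the low coordinates themselves, as the terms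
  without \<open>\<mu> j\<close> on the left require.\<close>

lemma high_energy_B:
  assumes k: "k \<in> {1..DIM('a)}" and u: "\<And>j. j \<in> {1..DIM('a)} \<Longrightarrow> j < k \<Longrightarrow> B u \<bullet> \<zeta> j = 0"
  shows "\<mu> k * (B u \<bullet> u) \<le> A u \<bullet> u"
  unfolding A_square B_square sum_distrib_left
proof (rule sum_mono)
  fix j assume j: "j \<in> {1..DIM('a)}"
  show "\<mu> k * ((coef u j)\<^sup>2 * b j) \<le> \<mu> j * (coef u j)\<^sup>2 * b j"
  proof (cases "j < k")
    case True
    then show ?thesis using u[OF j] by (simp add: coef_def)
  next
    case False
    then show ?thesis
      using mu_mono[OF k j] b_pos[OF j] by (simp add: mult.assoc mult_right_mono)
  qed
qed

end

section \<open>Bounds over coarse spaces of fixed dimension\<close>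

locale coarse_dimension = two_level_eig A R \<mu> \<zeta>
  for A R :: "'a::euclidean_space \<Rightarrow> 'a" and \<mu> \<zeta> +
  fixes nc :: nat
  assumes dim_N: "dim (op_kernel A) \<le> nc" and nc_less: "nc < DIM('a)"
begin

abbreviation "admissible \<equiv> admissible_coarse A nc"
abbreviation "Vopt \<equiv> span (\<zeta> ` {1..nc})"
abbreviation "\<nu> \<equiv> \<mu> (nc + 1)"

lemma nc1: "nc + 1 \<in> {1..DIM('a)}"
  using nc_less by auto

text \<open>Otherwise the first \<open>nc + 1\<close> eigenvectors would all lie in the kernel,
  whose dimension is at most \<open>nc\<close>.\<close>

lemma nu_pos: "0 < \<nu>"
proof (rule ccontr)
  assume "\<not> 0 < \<nu>"
  then have "\<mu> j = 0" if "j \<in> {1..nc + 1}" for j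
    using mu_mono[OF _ nc1, of j] mu_nonneg[of j] that nc_less by force
  then have "\<zeta> ` {1..nc + 1} \<subseteq> N"
    using nc_less by (auto simp: op_kernel_def A_zeta)
  then have "span (\<zeta> ` {1..nc + 1}) \<subseteq> N" by (intro span_minimal subspace_N)
  then have "nc + 1 \<le> dim N"
    using dim_subset[of "span (\<zeta> ` {1..nc + 1})" N] dim_span_zeta[of "nc + 1"] nc_less by linarith
  then show False using dim_N by simp
qed

text \<open>This vector is the \<open>x0\<close> of the attainment lemmas.\<close>

lemma zeta_nc1_W: "\<zeta> (nc + 1) \<in> W"
  using zeta_N_or_W[OF nc1] nu_pos A_zeta[OF nc1] b_pos[OF nc1] by (auto simp: op_kernel_def b_def)

lemma admissible_Vopt: "admissible Vopt"
proof -
  \<comment> \<open>Kernel vectors have no coordinates at positive eigenvalues, and all eigenvalues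
    beyond \<open>nc\<close> are positive.\<close>
  have "v \<in> Vopt" if "v \<in> N" for v
  proof (rule span_if_coef)
    fix j assume j: "j \<in> {1..DIM('a)}" "nc < j"
    then have "0 < \<mu> j" using nu_pos mu_mono[OF nc1 j(1)] by simp
    moreover have "A v \<bullet> \<zeta> j = 0" using that by (simp add: op_kernel_def)
    ultimately show "coef v j = 0" using A_zeta_coef[OF j(1), of v] b_pos[OF j(1)] by simp
  qed
  then show ?thesis
    using dim_span_zeta[of nc] nc_less by (auto simp: admissible_coarse_def simp del: dim_span)
qed

lemma zeta_N_or_coarse:
  assumes "j \<in> {1..DIM('a)}" "j < nc + 1" shows "\<zeta> j \<in> N \<or> \<zeta> j \<in> W_coarse A R Vopt"
  using zeta_N_or_W[OF assms(1)] assms by (auto simp: W_coarse_def intro!: span_base)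

text \<open>The energy left after smoothing \<open>\<zeta> (nc + 1)\<close> is nonnegative.\<close>

lemma nu_le_1: "\<nu> \<le> 1"
proof -
  let ?z = "\<zeta> (nc + 1)"
  have "A ?z \<bullet> ?z - Rbar A R (A ?z) \<bullet> A ?z = (1 - \<nu>) * (\<nu> * b (nc + 1))"
    using zeta_eig[OF nc1] by (simp add: A_zeta[OF nc1, simplified] b_def inner_commute algebra_simps)
  then have "0 \<le> (1 - \<nu>) * (\<nu> * b (nc + 1))"
    using A_nonneg[of "?z - R (A ?z)"] by (simp add: smoothing_energy)
  then show ?thesis using nu_pos b_pos[OF nc1] by (simp add: zero_le_mult_iff mult_le_0_iff)
qed

lemma energy_ratio:
  "(op_norm A x / op_norm A w)\<^sup>2 = (op_norm A x)\<^sup>2 / (A w \<bullet> w)"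
  using A_nonneg by (simp add: power_divide op_norm_def[of A w] op_inner_def)

lemma conv_rate_nonneg: assumes "subspace Vc" shows "0 \<le> conv_rate A R Vc"
  using conv_rate_witness[OF assms zeta_nc1_W zeta_nz[OF nc1]] A_nonneg
  by (auto simp: op_norm_def op_inner_def)

text \<open>The sum of the Gram maps of \<open>A\<close> on the coarse space and of \<open>inv (Rbar A R)\<close> on the kernel
  takes values in \<open>Vc\<close>, and vanishes only if both summands do; so one dimension count
  gives both orthogonality relations.\<close>

lemma conv_rate_lower:
  assumes Vc: "admissible Vc"
  shows "1 - \<nu> \<le> (conv_rate A R Vc)\<^sup>2"
proof -
  let ?S = "W_coarse A R Vc"
  have V: "subspace Vc" "dim Vc = nc" "N \<subseteq> Vc" using Vc by (auto simp: admissible_coarse_def)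
  have S: "subspace ?S" by (rule subspace_W_coarse[OF V(1)])
  obtain f where f: "linear f" "\<And>x. f x \<in> ?S" "\<And>x s. s \<in> ?S \<Longrightarrow> f x \<bullet> s = A x \<bullet> s"
    using gram_map_exists[OF S linear_A] by blast
  obtain g where g: "linear g" "\<And>x. g x \<in> N" "\<And>x s. s \<in> N \<Longrightarrow> g x \<bullet> s = B x \<bullet> s"
    using gram_map_exists[OF subspace_N linear_B] by blast
  let ?T = "span (\<zeta> ` {1..nc + 1})"
  have fgV: "f x + g x \<in> Vc" for x
    using f(2)[of x] g(2)[of x] V(1,3) by (auto simp: W_coarse_def intro!: subspace_add)
  have "dim Vc < dim ?T" using dim_span_zeta[of "nc + 1"] nc_less V(2) by simp
  then obtain u where u: "u \<in> ?T" "u \<noteq> 0" "f u + g u = 0"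
    using linear_kernel_vector[OF linear_compose_add[OF f(1) g(1)] subspace_span, of "\<zeta> ` {1..nc + 1}" Vc] fgV
    by blast
  have fu: "f u = - g u" using u(3) by (simp add: add_eq_0_iff)
  then have "f u \<in> N" using g(2) subspace_N by (simp add: subspace_neg)
  moreover have "f u \<in> W" using f(2)[of u] by (simp add: W_coarse_def)
  ultimately have f0: "f u = 0" by (rule W_inter_N[rotated])
  then have g0: "g u = 0" using fu by simp
  have uW: "u \<in> W" unfolding W_iff using g(3)[of _ u] g0 by simp
  \<comment> \<open>\<open>f u = 0\<close> says that \<open>u\<close> is orthogonal for
    \<open>A\<close> to the coarse part of \<open>W\<close>, so only the smoothing step acts on
    it.\<close>
  have "coarse_proj A R Vc u = 0"
    using f(3)[of _ u] f0 S by (intro coarse_proj_unique[OF V(1)])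
      (auto simp: subspace_0 linear_0[OF linear_A])
  then have E: "(op_norm A (two_level_E A R Vc u))\<^sup>2 = A u \<bullet> u - Rbar A R (A u) \<bullet> A u"
    by (simp add: two_level_energy)
  have Apos: "0 < A u \<bullet> u" by (rule A_pos[OF uW u(2)])
  have "1 - \<nu> \<le> (op_norm A (two_level_E A R Vc u) / op_norm A u)\<^sup>2"
    unfolding energy_ratio E pos_le_divide_eq[OF Apos] using low_energy(1)[OF nc1 u(1)]
    by (simp add: algebra_simps)
  also have "\<dots> \<le> (conv_rate A R Vc)\<^sup>2"
    using conv_rate_upper[OF V(1) zeta_nc1_W zeta_nz[OF nc1], of u] uW u(2) A_nonneg
    by (intro power_mono) (auto simp: op_norm_def op_inner_def)
  finally show ?thesis .
qed

lemma conv_rate_opt: "(conv_rate A R Vopt)\<^sup>2 = 1 - \<nu>"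
proof (rule antisym)
  show "1 - \<nu> \<le> (conv_rate A R Vopt)\<^sup>2" by (rule conv_rate_lower[OF admissible_Vopt])
  have V: "subspace Vopt" by (rule subspace_span)
  obtain w where w: "w \<in> W - {0}"
    "conv_rate A R Vopt = op_norm A (two_level_E A R Vopt w) / op_norm A w"
    using conv_rate_witness[OF V zeta_nc1_W zeta_nz[OF nc1]] by blast
  define p where "p = coarse_proj A R Vopt w"
  define u where "u = w - p"
  have pin: "p \<in> W_coarse A R Vopt" unfolding p_def by (rule coarse_proj_in[OF V])
  have orth: "A u \<bullet> s = 0" if "s \<in> W_coarse A R Vopt" for s
    using coarse_proj_eq[OF V that, of w]
    by (simp add: u_def p_def linear_diff[OF linear_A] inner_diff_left)
  \<comment> \<open>The projection controls only vectors of \<open>W\<close>; the other eigenvectors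
    lie in the kernel, which is orthogonal for \<open>A\<close> to everything.\<close>
  have "A u \<bullet> \<zeta> j = 0" if "j \<in> {1..DIM('a)}" "j < nc + 1" for j
    using zeta_N_or_coarse[OF that] orth[of "\<zeta> j"] A_sym[of u "\<zeta> j"] by (auto simp: op_kernel_def)
  then have high: "\<nu> * (A u \<bullet> u) \<le> Rbar A R (A u) \<bullet> A u"
    by (rule high_energy_A[OF nc1])
  have "A u \<bullet> u \<le> A w \<bullet> w"
    using A_add_square[OF orth[OF pin]] A_nonneg[of p] by (simp add: u_def)
  \<comment> \<open>Passing from the remainder \<open>u\<close> back to \<open>w\<close> needs a
    nonnegative factor, whence \<open>nu_le_1\<close>.\<close>
  then have "(1 - \<nu>) * (A u \<bullet> u) \<le> (1 - \<nu>) * (A w \<bullet> w)"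
    using nu_le_1 by (intro mult_left_mono) auto
  moreover have "(op_norm A (two_level_E A R Vopt w))\<^sup>2 \<le> (1 - \<nu>) * (A u \<bullet> u)"
    using high two_level_energy[of Vopt w] by (simp add: u_def p_def algebra_simps)
  moreover have "0 < A w \<bullet> w" using A_pos w(1) by blast
  ultimately show "(conv_rate A R Vopt)\<^sup>2 \<le> 1 - \<nu>"
    unfolding w(2) energy_ratio by (simp add: pos_divide_le_eq)
qed

text \<open>A single Gram map, that of \<open>B\<close> on all of \<open>Vc\<close>, suffices: its
  zero \<open>u\<close> lies in \<open>W\<close> because \<open>Vc\<close> contains the kernel, and
  has \<open>Q u = 0\<close>.\<close>

lemma K_const_lower:
  assumes Vc: "admissible Vc"
  shows "1 / \<nu> \<le> K_const A R Vc"
proof -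
  have V: "subspace Vc" "dim Vc = nc" "N \<subseteq> Vc" using Vc by (auto simp: admissible_coarse_def)
  obtain Q where Q: "\<And>u. Q u \<in> W_coarse A R Vc"
    "\<And>u s. s \<in> W_coarse A R Vc \<Longrightarrow> B (Q u) \<bullet> s = B u \<bullet> s"
    "\<And>u. u \<in> W - {0} \<Longrightarrow> B (u - Q u) \<bullet> (u - Q u) / (A u \<bullet> u) \<le> K_const A R Vc"
    using K_const_attained[OF V(1) zeta_nc1_W zeta_nz[OF nc1]] by metis
  obtain f where f: "linear f" "\<And>x. f x \<in> Vc" "\<And>x s. s \<in> Vc \<Longrightarrow> f x \<bullet> s = B x \<bullet> s"
    using gram_map_exists[OF V(1) linear_B] by blast
  let ?T = "span (\<zeta> ` {1..nc + 1})"
  have "dim Vc < dim ?T" using dim_span_zeta[of "nc + 1"] nc_less V(2) by simp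
  then obtain u where u: "u \<in> ?T" "u \<noteq> 0" "f u = 0"
    using linear_kernel_vector[OF f(1) subspace_span, of "\<zeta> ` {1..nc + 1}" Vc] f(2) by blast
  have orth: "B u \<bullet> s = 0" if "s \<in> Vc" for s using f(3)[OF that, of u] u(3) by simp
  have uW: "u \<in> W" unfolding W_iff using orth V(3) by blast
  have "Q u \<in> Vc" using Q(1)[of u] by (simp add: W_coarse_def)
  then have "B (Q u) \<bullet> Q u = 0" using Q(2)[OF Q(1), of u u] orth by simp
  then have "Q u = 0" using B_pos by fastforce
  then have "B u \<bullet> u / (A u \<bullet> u) \<le> K_const A R Vc" using Q(3)[of u] uW u(2) by simp
  moreover have "1 / \<nu> \<le> B u \<bullet> u / (A u \<bullet> u)"
    using low_energy(2)[OF nc1 u(1)] nu_pos A_pos[OF uW u(2)]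
    by (simp add: divide_simps mult.commute)
  ultimately show ?thesis by linarith
qed

lemma K_const_opt: "K_const A R Vopt \<le> 1 / \<nu>"
proof -
  have V: "subspace Vopt" by (rule subspace_span)
  obtain Q v where Q: "\<And>u. Q u \<in> W_coarse A R Vopt"
    "\<And>u s. s \<in> W_coarse A R Vopt \<Longrightarrow> B (Q u) \<bullet> s = B u \<bullet> s"
    and v: "v \<in> W - {0}" "K_const A R Vopt = B (v - Q v) \<bullet> (v - Q v) / (A v \<bullet> v)"
    using K_const_attained[OF V zeta_nc1_W zeta_nz[OF nc1]] by metis
  define u where "u = v - Q v"
  have uW: "u \<in> W"
    using v(1) Q(1)[of v] subspace_W by (auto simp: u_def W_coarse_def intro: subspace_diff)
  \<comment> \<open>Eigenvectors in the kernel are covered by membership of \<open>u\<close> in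
    \<open>W\<close>, the others by the projection \<open>Q\<close>.\<close>
  have orthB: "B u \<bullet> \<zeta> j = 0" if "j \<in> {1..DIM('a)}" "j < nc + 1" for j
    using zeta_N_or_coarse[OF that] Q(2)[of "\<zeta> j" v] uW
    by (auto simp: W_iff u_def linear_diff[OF linear_B] inner_diff_left)
  then have high: "\<nu> * (B u \<bullet> u) \<le> A u \<bullet> u"
    by (rule high_energy_B[OF nc1])
  \<comment> \<open>Both forms are diagonal in the eigenbasis, so orthogonality passes from
    \<open>B\<close> to \<open>A\<close>. Hence Pythagoras also holds for \<open>A\<close>, although
    \<open>Q\<close> projects with respect to \<open>B\<close>.\<close>
  have "A u \<bullet> \<zeta> j = 0" if "j \<in> {1..nc}" for j
    using orthB[of j] A_zeta_coef[of j u] that nc_less by (simp add: coef_def)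
  then have "Vopt \<subseteq> {s. A u \<bullet> s = 0}"
    by (intro span_minimal) (auto simp: subspace_def inner_add_right)
  then have "A u \<bullet> Q v = 0" using Q(1)[of v] by (auto simp: W_coarse_def)
  from A_add_square[OF this] have "A u \<bullet> u \<le> A v \<bullet> v"
    using A_nonneg[of "Q v"] by (simp add: u_def)
  then have "\<nu> * (B u \<bullet> u) \<le> A v \<bullet> v" using high by linarith
  then have "B u \<bullet> u \<le> 1 / \<nu> * (A v \<bullet> v)" using nu_pos by (simp add: field_simps)
  moreover have "0 < A v \<bullet> v" using A_pos v(1) by blast
  ultimately show ?thesis
    unfolding v(2) u_def[symmetric] by (simp only: pos_divide_le_eq)
qed

lemma Vopt_optimal:
  "is_arg_min (conv_rate A R) admissible Vopt"
  "is_arg_min (K_const A R) admissible Vopt"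
proof -
  have "conv_rate A R Vopt \<le> conv_rate A R Vc" if "admissible Vc" for Vc
  proof (rule power2_le_imp_le)
    show "(conv_rate A R Vopt)\<^sup>2 \<le> (conv_rate A R Vc)\<^sup>2"
      unfolding conv_rate_opt by (rule conv_rate_lower[OF that])
    show "0 \<le> conv_rate A R Vc" using conv_rate_nonneg that by (simp add: admissible_coarse_def)
  qed
  then show "is_arg_min (conv_rate A R) admissible Vopt"
    using admissible_Vopt by (simp add: is_arg_min_linorder)
  show "is_arg_min (K_const A R) admissible Vopt"
    using admissible_Vopt K_const_opt K_const_lower by (force simp: is_arg_min_linorder)
qed

end

theorem theorem5p5:
  fixes A R :: "'a::euclidean_space \<Rightarrow> 'a"
    and \<mu> :: "nat \<Rightarrow> real" and \<zeta> :: "nat \<Rightarrow> 'a" and n\<^sub>c :: nat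
  assumes "spsd_op A" and "\<exists>v. A v \<noteq> 0"
    and "linear R" and "spd_op (Rbar A R)"
    and "\<forall>j\<in>{1..DIM('a)}. \<zeta> j \<noteq> 0 \<and> Rbar A R (A (\<zeta> j)) = \<mu> j *\<^sub>R \<zeta> j"
    and "\<forall>i\<in>{1..DIM('a)}. \<forall>j\<in>{1..DIM('a)}. i \<le> j \<longrightarrow> \<mu> i \<le> \<mu> j"
    and "\<forall>i\<in>{1..DIM('a)}. \<forall>j\<in>{1..DIM('a)}. i \<noteq> j \<longrightarrow>
           op_inner (inv (Rbar A R)) (\<zeta> i) (\<zeta> j) = 0"
    and "dim (op_kernel A) \<le> n\<^sub>c" and "n\<^sub>c < DIM('a)"
  shows "is_arg_min (conv_rate A R) (admissible_coarse A n\<^sub>c) (span (\<zeta> ` {1..n\<^sub>c}))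
       \<and> is_arg_min (K_const A R) (admissible_coarse A n\<^sub>c) (span (\<zeta> ` {1..n\<^sub>c}))
       \<and> (conv_rate A R (span (\<zeta> ` {1..n\<^sub>c})))\<^sup>2 = 1 - \<mu> (n\<^sub>c + 1)"
proof -
  interpret coarse_dimension A R \<mu> \<zeta> n\<^sub>c
    by (intro coarse_dimension.intro coarse_dimension_axioms.intro two_level_eig.intro
        two_level_eig_axioms.intro two_level.intro)
      (use assms in \<open>unfold op_inner_def, blast+\<close>)
  show ?thesis using Vopt_optimal conv_rate_opt by blast
qed

end
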